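(* The space $\mathcal{C}_1(\mathbb{S})$ of all non-empty closed intervals of the Sorgenfrey line $\mathbb{S}$, with the (subspace) Vietoris topology, is homogeneous.
   Context: $\mathbb{S}$ denotes the Sorgenfrey line; since the Sorgenfrey line is homeomorphic to its subspace $[0,1[$, one takes $\mathbb{S}=[0,1[$ with the topology having as base the half-open intervals $[c,d[$, $0\le c<d\le 1$. Vietoris topology: for a space $X$, $\operatorname{Exp}(X)$ is the set of all non-empty closed subsets of $X$, with the topology generated by the subbase of all sets $[V]=\{F\in\operatorname{Exp}(X):F\subset V\}$ and $\langle V\rangle=\{F\in\operatorname{Exp}(X):F\cap V\neq\emptyset\}$, $V$ a non-empty open subset of $X$. $\mathcal{C}_1(\mathbb{S})\subset\operatorname{Exp}(\mathbb{S})$ is the subspace of all non-empty closed intervals $[a,b]=\{z\in\mathbb{S}:a\le z\le b\}$ with $a,b\in\mathbb{S}$, $a\le b$. A topological space $Y$ is homogeneous if for all $x,y\in Y$ there is a homeomorphism $h:Y\to Y$ with $h(x)=y$. *)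

theory Defs
  imports "HOL-Analysis.Analysis"
begin

text \<open>
  The Sorgenfrey line, realised as \<open>[0,1)\<close>.  The generating family is given to the library as a
  subbase; it is in fact a base, see \<open>openin_sorgenfrey_iff\<close>.
\<close>

definition sorgenfrey :: "real topology" where
  "sorgenfrey = topology_generated_by {{c..<d} | c d. 0 \<le> c \<and> c < d \<and> d \<le> 1}"

lemma topspace_sorgenfrey [simp]: "topspace sorgenfrey = {0..<1}"
  unfolding sorgenfrey_def topology_generated_by_topspace
  by (fastforce intro: exI[of _ "{0..<1::real}"])

lemma openin_sorgenfrey_iff:
  "openin sorgenfrey U \<longleftrightarrow>
     (\<forall>x\<in>U. \<exists>c d. 0 \<le> c \<and> c < d \<and> d \<le> 1 \<and> x \<in> {c..<d} \<and> {c..<d} \<subseteq> U)"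
    (is "_ \<longleftrightarrow> ?P U")
proof
  assume "openin sorgenfrey U"
  then have "generate_topology_on {{c..<d} | c d. 0 \<le> c \<and> c < d \<and> d \<le> (1::real)} U"
    by (simp add: sorgenfrey_def openin_topology_generated_by_iff)
  then show "?P U"
  proof induction
    case (Int a b)
    show ?case
    proof
      fix x assume "x \<in> a \<inter> b"
      with Int.IH obtain c d c' d' where
        "0 \<le> c" "d \<le> 1" "x \<in> {c..<d}" "{c..<d} \<subseteq> a" "x \<in> {c'..<d'}" "{c'..<d'} \<subseteq> b"
        by (meson IntD1 IntD2)
      then have "0 \<le> max c c' \<and> max c c' < min d d' \<and> min d d' \<le> 1 \<and>
          x \<in> {max c c'..<min d d'} \<and> {max c c'..<min d d'} \<subseteq> a \<inter> b"
        by auto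
      then show "\<exists>c d. 0 \<le> c \<and> c < d \<and> d \<le> 1 \<and> x \<in> {c..<d} \<and> {c..<d} \<subseteq> a \<inter> b"
        by blast
    qed
  next
    case (UN K)
    then show ?case by (meson UnionE Union_upper subset_trans)
  qed blast+
next
  assume P: "?P U"
  have "openin sorgenfrey {c..<d}" if "0 \<le> c" "c < d" "d \<le> 1" for c d :: real
    unfolding sorgenfrey_def by (rule topology_generated_by_Basis) (use that in blast)
  with P show "openin sorgenfrey U"
    by (subst openin_subopen) meson
qed

definition Exp :: "'a topology \<Rightarrow> 'a set set" where
  "Exp X = {F. closedin X F \<and> F \<noteq> {}}"

definition vietoris :: "'a topology \<Rightarrow> 'a set topology" where
  "vietoris X = topology_generated_by
     ({{F \<in> Exp X. F \<subseteq> V} | V. openin X V \<and> V \<noteq> {}} \<union>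
      {{F \<in> Exp X. F \<inter> V \<noteq> {}} | V. openin X V \<and> V \<noteq> {}})"

lemma topspace_vietoris [simp]: "topspace (vietoris X) = Exp X"
proof
  show "topspace (vietoris X) \<subseteq> Exp X"
    unfolding vietoris_def topology_generated_by_topspace by blast
  show "Exp X \<subseteq> topspace (vietoris X)"
  proof
    fix F assume F: "F \<in> Exp X"
    then have "F \<subseteq> topspace X" "F \<noteq> {}"
      by (auto simp: Exp_def dest: closedin_subset)
    with F show "F \<in> topspace (vietoris X)"
      unfolding vietoris_def topology_generated_by_topspace
      by (intro UnionI[of "{F \<in> Exp X. F \<subseteq> topspace X}"]) auto
  qed
qed

definition C1_sorgenfrey :: "real set topology" where
  "C1_sorgenfrey = subtopology (vietoris sorgenfrey)
     {{z \<in> topspace sorgenfrey. a \<le> z \<and> z \<le> b} | a b.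
        a \<in> topspace sorgenfrey \<and> b \<in> topspace sorgenfrey \<and> a \<le> b}"

text \<open>
  A subtopology silently drops sets outside the ambient space; here nothing is lost, because
  all the intervals are closed in the Sorgenfrey line.
\<close>

lemma topspace_C1_sorgenfrey:
  "topspace C1_sorgenfrey = {{a..b} | a b. 0 \<le> a \<and> a \<le> b \<and> b < 1}"
proof -
  have eq: "{z \<in> topspace sorgenfrey. a \<le> z \<and> z \<le> b} = {a..b}" if "0 \<le> a" "b < 1" for a b
    using that by auto
  have closed: "{a..b} \<in> Exp sorgenfrey" if "0 \<le> a" "a \<le> b" "b < 1" for a b
  proof -
    have "openin sorgenfrey ({0..<1} - {a..b})"
      unfolding openin_sorgenfrey_iff
    proof
      fix x assume x: "x \<in> {0..<1} - {a..b}"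
      show "\<exists>c d. 0 \<le> c \<and> c < d \<and> d \<le> 1 \<and> x \<in> {c..<d} \<and> {c..<d} \<subseteq> {0..<1} - {a..b}"
      proof (cases "x < a")
        case True
        with x that show ?thesis by (intro exI[of _ 0] exI[of _ a]) auto
      next
        case False
        with x that show ?thesis by (intro exI[of _ x] exI[of _ 1]) auto
      qed
    qed
    with that show ?thesis by (auto simp: Exp_def closedin_def)
  qed
  have "{{z \<in> topspace sorgenfrey. a \<le> z \<and> z \<le> b} | a b.
           a \<in> topspace sorgenfrey \<and> b \<in> topspace sorgenfrey \<and> a \<le> b}
      = {{a..b} | a b. 0 \<le> a \<and> a \<le> b \<and> b < 1}" (is "?L = ?R")
  proof
    show "?L \<subseteq> ?R"
    proof
      fix F assume "F \<in> ?L"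
      then obtain a b where "F = {z \<in> topspace sorgenfrey. a \<le> z \<and> z \<le> b}"
        "0 \<le> a" "a \<le> b" "b < 1" by auto
      with eq show "F \<in> ?R" by blast
    qed
    show "?R \<subseteq> ?L"
    proof
      fix F assume "F \<in> ?R"
      then obtain a b where "F = {a..b}" "0 \<le> a" "a \<le> b" "b < 1" by auto
      then have "F = {z \<in> topspace sorgenfrey. a \<le> z \<and> z \<le> b}"
        "a \<in> topspace sorgenfrey" "b \<in> topspace sorgenfrey" "a \<le> b"
        using eq by auto
      then show "F \<in> ?L" by blast
    qed
  qed
  with closed show ?thesis
    unfolding C1_sorgenfrey_def topspace_subtopology topspace_vietoris by auto
qed

definition homogeneous_space :: "'a topology \<Rightarrow> bool" where
  "homogeneous_space Y \<longleftrightarrow>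
     (\<forall>x\<in>topspace Y. \<forall>y\<in>topspace Y. \<exists>h. homeomorphic_map Y Y h \<and> h x = y)"

end

theory Submission
  imports Defs
begin

text \<open>
  Sending \<open>(a, b)\<close> to \<open>[a, b]\<close> identifies the space of intervals with the triangle \<open>a \<le> b\<close> in the
  square of the Sorgenfrey line \<open>[0,1)\<close>.  The triangle is homeomorphic to the whole square:
  there are sequences \<open>1 = p 0 x > p 1 x > \<dots>\<close> converging to \<open>x\<close> such that each
  \<open>p k\<close> is constant on some \<open>[x, x + \<delta>)\<close>, and one maps the fibre \<open>[x, 1)\<close> over \<open>x\<close> onto \<open>[0, 1)\<close> by
  sending \<open>x\<close> to \<open>0\<close> and \<open>[p (k + 1) x, p k x)\<close> affinely onto \<open>[1/2^(k + 1), 1/2^k)\<close>.  Because the break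
  points are locally constant in \<open>x\<close>, this is continuous in both directions, also at the diagonal.
  The square is homogeneous because rotations of \<open>[0, 1)\<close> modulo \<open>1\<close> are homeomorphisms.
\<close>

section \<open>Homogeneous spaces\<close>

lemma homogeneous_space_homeomorphic:
  assumes "X homeomorphic_space Y" and "homogeneous_space Y"
  shows "homogeneous_space X"
  unfolding homogeneous_space_def
proof (intro ballI)
  fix x y assume xy: "x \<in> topspace X" "y \<in> topspace X"
  obtain f g where fg: "homeomorphic_maps X Y f g"
    using assms(1) unfolding homeomorphic_space_def by blast
  then have f: "homeomorphic_map X Y f" and g: "homeomorphic_map Y X g" and gf: "g (f y) = y"
    using xy by (auto simp: homeomorphic_maps_map)
  have "f x \<in> topspace Y" "f y \<in> topspace Y"
    using xy homeomorphic_imp_surjective_map[OF f] by auto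
  then obtain h where h: "homeomorphic_map Y Y h" "h (f x) = f y"
    using assms(2) unfolding homogeneous_space_def by blast
  have "homeomorphic_map X X (g \<circ> (h \<circ> f))"
    using f g h(1) by (meson homeomorphic_map_compose)
  with h(2) gf show "\<exists>h. homeomorphic_map X X h \<and> h x = y"
    by (intro exI[of _ "g \<circ> (h \<circ> f)"]) simp
qed

lemma homogeneous_space_prod_topology:
  assumes "homogeneous_space X" and "homogeneous_space Y"
  shows "homogeneous_space (prod_topology X Y)"
  unfolding homogeneous_space_def
proof (intro ballI)
  fix z w assume "z \<in> topspace (prod_topology X Y)" "w \<in> topspace (prod_topology X Y)"
  then obtain f g where fg: "homeomorphic_map X X f" "f (fst z) = fst w"
      "homeomorphic_map Y Y g" "g (snd z) = snd w"
    using assms unfolding homogeneous_space_def by (auto simp: mem_Times_iff) metis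
  obtain f' g' where "homeomorphic_maps X X f f'" "homeomorphic_maps Y Y g g'"
    using fg by (auto simp: homeomorphic_map_maps)
  then have "homeomorphic_maps (prod_topology X Y) (prod_topology X Y)
      (\<lambda>(x,y). (f x, g y)) (\<lambda>(x,y). (f' x, g' y))"
    by (simp add: homeomorphic_maps_prod)
  then have "homeomorphic_map (prod_topology X Y) (prod_topology X Y) (\<lambda>(x,y). (f x, g y))"
    by (auto simp: homeomorphic_map_maps)
  with fg show "\<exists>h. homeomorphic_map (prod_topology X Y) (prod_topology X Y) h \<and> h z = w"
    by (intro exI[of _ "\<lambda>(x,y). (f x, g y)"]) (auto simp: case_prod_beta prod_eq_iff)
qed

section \<open>The Sorgenfrey line and subspaces of its square\<close>

lemma openin_sorgenfreyI:
  assumes "U \<subseteq> {0..<1}" and "\<And>x. x \<in> U \<Longrightarrow> \<exists>d>0. {x..<x + d} \<inter> {0..<1} \<subseteq> U"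
  shows "openin sorgenfrey U"
  unfolding openin_sorgenfrey_iff
proof
  fix x assume x: "x \<in> U"
  then obtain d where d: "d > 0" "{x..<x + d} \<inter> {0..<1} \<subseteq> U"
    using assms(2) by blast
  have "0 \<le> x" "x < 1" using x assms(1) by auto
  with d show "\<exists>c d. 0 \<le> c \<and> c < d \<and> d \<le> 1 \<and> x \<in> {c..<d} \<and> {c..<d} \<subseteq> U"
    by (intro exI[of _ x] exI[of _ "min (x + d) 1"]) auto
qed

lemma openin_sorgenfreyD:
  assumes "openin sorgenfrey U" and "x \<in> U"
  shows "\<exists>d>0. {x..<x + d} \<subseteq> U"
proof -
  obtain c d where "x \<in> {c..<d}" "{c..<d} \<subseteq> U"
    using assms unfolding openin_sorgenfrey_iff by blast
  then show ?thesis
    by (intro exI[of _ "d - x"]) (auto simp: subset_iff)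
qed

lemma openin_sorgenfrey_atLeastLessThan:
  assumes "0 \<le> a" shows "openin sorgenfrey ({a..<b} \<inter> {0..<1})"
proof (rule openin_sorgenfreyI)
  fix x assume "x \<in> {a..<b} \<inter> {0..<1}"
  then show "\<exists>d>0. {x..<x + d} \<inter> {0..<1} \<subseteq> {a..<b} \<inter> {0..<1}"
    by (intro exI[of _ "b - x"]) auto
qed auto

text \<open>The intervals \<open>[f x, f x + e)\<close> form a neighbourhood base at
  \<open>f x\<close>, so near \<open>x\<close> the values must not drop and may rise by less than
  \<open>e\<close>.\<close>

lemma continuous_map_sorgenfreyI:
  assumes "f \<in> topspace X \<rightarrow> {0..<1}"
    and "\<And>x e. x \<in> topspace X \<Longrightarrow> e > 0 \<Longrightarrow>
           \<exists>U. openin X U \<and> x \<in> U \<and> (\<forall>z\<in>U. f x \<le> f z \<and> f z < f x + e)"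
  shows "continuous_map X sorgenfrey f"
  unfolding continuous_map_eq_topcontinuous_at topcontinuous_at_def
proof (intro ballI conjI allI impI)
  fix x V assume x: "x \<in> topspace X" and "openin sorgenfrey V \<and> f x \<in> V"
  then obtain e where e: "e > 0" "{f x..<f x + e} \<subseteq> V"
    using openin_sorgenfreyD by blast
  obtain U where "openin X U" "x \<in> U" "\<forall>z\<in>U. f x \<le> f z \<and> f z < f x + e"
    using assms(2)[OF x e(1)] by blast
  with e(2) show "\<exists>U. openin X U \<and> x \<in> U \<and> (\<forall>y\<in>U. f y \<in> V)"
    by (intro exI[of _ U]) (auto simp: subset_iff)
qed (use assms(1) in auto)

abbreviation sorgenfrey_plane :: "(real \<times> real) set \<Rightarrow> (real \<times> real) topology" where
  "sorgenfrey_plane \<equiv> subtopology (prod_topology sorgenfrey sorgenfrey)"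

lemma openin_sorgenfrey_planeI:
  assumes D: "D \<subseteq> {0..<1} \<times> {0..<1}" and W: "W \<subseteq> D"
    and box: "\<And>x y. (x, y) \<in> W \<Longrightarrow> \<exists>d>0. D \<inter> {x..<x + d} \<times> {y..<y + d} \<subseteq> W"
  shows "openin (sorgenfrey_plane D) W"
proof (subst openin_subopen, intro ballI)
  fix z assume z: "z \<in> W"
  then obtain d where d: "d > 0" "D \<inter> {fst z..<fst z + d} \<times> {snd z..<snd z + d} \<subseteq> W"
    using box[of "fst z" "snd z"] by auto
  define B where "B = ({fst z..<fst z + d} \<inter> {0..<1}) \<times> ({snd z..<snd z + d} \<inter> {0..<1})"
  have z01: "0 \<le> fst z" "fst z < 1" "0 \<le> snd z" "snd z < 1" "z \<in> D"
    using z W D by auto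
  then have "openin (prod_topology sorgenfrey sorgenfrey) B"
    unfolding B_def openin_prod_Times_iff using openin_sorgenfrey_atLeastLessThan by blast
  then have "openin (sorgenfrey_plane D) (D \<inter> B)"
    by (simp add: openin_subtopology_Int2)
  moreover have "D \<inter> B \<subseteq> W" "z \<in> D \<inter> B"
    using d z01 by (auto simp: B_def mem_Times_iff)
  ultimately show "\<exists>T. openin (sorgenfrey_plane D) T \<and> z \<in> T \<and> T \<subseteq> W"
    by blast
qed

text \<open>The pointwise estimate has to yield an open neighbourhood. The points above and to the
  right of \<open>z\<close> with values in the required window form one: the estimate, used again at
  each of them, never lets the value drop.\<close>

lemma continuous_map_sorgenfrey_plane_sorgenfreyI:
  assumes D: "D \<subseteq> {0..<1} \<times> {0..<1}"
    and range: "\<And>x y. (x, y) \<in> D \<Longrightarrow> f (x, y) \<in> {0..<1}"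
    and cont: "\<And>x y e. (x, y) \<in> D \<Longrightarrow> e > 0 \<Longrightarrow>
           \<exists>d>0. \<forall>x'\<in>{x..<x + d}. \<forall>y'\<in>{y..<y + d}. (x', y') \<in> D \<longrightarrow>
              f (x, y) \<le> f (x', y') \<and> f (x', y') < f (x, y) + e"
  shows "continuous_map (sorgenfrey_plane D) sorgenfrey f"
proof (rule continuous_map_sorgenfreyI)
  have top: "topspace (sorgenfrey_plane D) = D"
    using D by auto
  show "f \<in> topspace (sorgenfrey_plane D) \<rightarrow> {0..<1}"
    unfolding top using range by auto
  fix z e assume "z \<in> topspace (sorgenfrey_plane D)" "(e::real) > 0"
  then have z: "(fst z, snd z) \<in> D" and e: "e > 0"
    unfolding top by auto
  define U where "U = {w \<in> D. fst z \<le> fst w \<and> snd z \<le> snd w \<and> f z \<le> f w \<and> f w < f z + e}"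
  have "openin (sorgenfrey_plane D) U"
  proof (rule openin_sorgenfrey_planeI[OF D])
    fix x y assume xy: "(x, y) \<in> U"
    then have "(x, y) \<in> D" "f z + e - f (x, y) > 0" by (auto simp: U_def)
    \<comment> \<open>The tolerance is the slack that \<open>f (x, y)\<close> leaves below
      \<open>f z + e\<close>.\<close>
    from cont[OF this] obtain d where "d > 0" and
      d: "\<forall>x'\<in>{x..<x + d}. \<forall>y'\<in>{y..<y + d}. (x', y') \<in> D \<longrightarrow>
              f (x, y) \<le> f (x', y') \<and> f (x', y') < f (x, y) + (f z + e - f (x, y))"
      by blast
    have "(x', y') \<in> U" if "(x', y') \<in> D" "x' \<in> {x..<x + d}" "y' \<in> {y..<y + d}" for x' y'
    proof -
      have "f (x, y) \<le> f (x', y') \<and> f (x', y') < f z + e"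
        using d that by simp
      then show ?thesis using xy that by (auto simp: U_def)
    qed
    with \<open>d > 0\<close> show "\<exists>d>0. D \<inter> {x..<x + d} \<times> {y..<y + d} \<subseteq> U"
      by blast
  qed (auto simp: U_def)
  then show "\<exists>U. openin (sorgenfrey_plane D) U \<and> z \<in> U \<and> (\<forall>w\<in>U. f z \<le> f w \<and> f w < f z + e)"
    using z e by (intro exI[of _ U]) (auto simp: U_def)
qed

section \<open>Rotations and homogeneity of the Sorgenfrey line\<close>

lemma continuous_map_rotation:
  "continuous_map sorgenfrey sorgenfrey (\<lambda>x. frac (x + c))"
proof (rule continuous_map_sorgenfreyI)
  fix x e :: real assume x: "x \<in> topspace sorgenfrey" and e: "e > 0"
  \<comment> \<open>\<open>1 - frac (x + c)\<close> is the room left before wrapping around, so on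
    \<open>[x, x + d)\<close> the rotation is a plain translation.\<close>
  define d where "d = min e (1 - frac (x + c))"
  have d: "d > 0" using e frac_lt_1[of "x + c"] by (simp add: d_def)
  have shift: "frac (z + c) = frac (x + c) + (z - x)" if "z \<in> {x..<x + d}" for z
  proof -
    have "z + c - (frac (x + c) + (z - x)) = of_int \<lfloor>x + c\<rfloor>"
      by (simp add: frac_def)
    then have "z + c - (frac (x + c) + (z - x)) \<in> \<int>"
      by (metis Ints_of_int)
    moreover have "0 \<le> frac (x + c) + (z - x)" "frac (x + c) + (z - x) < 1"
      using that frac_ge_0[of "x + c"] by (auto simp: d_def)
    ultimately show ?thesis
      unfolding frac_unique_iff by blast
  qed
  have "frac (x + c) \<le> frac (z + c) \<and> frac (z + c) < frac (x + c) + e" if "z \<in> {x..<x + d}" for z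
    using that unfolding shift[OF that] by (auto simp: d_def)
  moreover have "openin sorgenfrey ({x..<x + d} \<inter> {0..<1})"
    using x by (intro openin_sorgenfrey_atLeastLessThan) auto
  ultimately show "\<exists>U. openin sorgenfrey U \<and> x \<in> U \<and>
      (\<forall>z\<in>U. frac (x + c) \<le> frac (z + c) \<and> frac (z + c) < frac (x + c) + e)"
    using x d by (intro exI[of _ "{x..<x + d} \<inter> {0..<1}"]) auto
qed (auto simp: frac_ge_0 frac_lt_1)

lemma frac_rotate_back:
  fixes x c :: real
  assumes "x \<in> {0..<1}" shows "frac (frac (x + c) + - c) = x"
proof -
  have "frac (x + c) + - c - x = of_int (- \<lfloor>x + c\<rfloor>)"
    by (simp add: frac_def)
  then have "frac (x + c) + - c - x \<in> \<int>"
    by (metis Ints_of_int)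
  then show ?thesis
    unfolding frac_unique_iff using assms by simp
qed

lemma homogeneous_space_sorgenfrey: "homogeneous_space sorgenfrey"
  unfolding homogeneous_space_def
proof (intro ballI)
  fix x y assume xy: "x \<in> topspace sorgenfrey" "y \<in> topspace sorgenfrey"
  define c where "c = y - x"
  have "homeomorphic_maps sorgenfrey sorgenfrey (\<lambda>z. frac (z + c)) (\<lambda>z. frac (z + - c))"
    unfolding homeomorphic_maps_def
  proof (intro conjI ballI)
    fix z assume "z \<in> topspace sorgenfrey"
    then have z: "z \<in> {0..<1}" by simp
    show "frac (frac (z + c) + - c) = z" by (rule frac_rotate_back[OF z])
    show "frac (frac (z + - c) + c) = z" using frac_rotate_back[OF z, of "- c"] by simp
  qed (rule continuous_map_rotation)+
  moreover have "frac (x + c) = y"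
    using xy by (simp add: c_def frac_eq)
  ultimately show "\<exists>h. homeomorphic_map sorgenfrey sorgenfrey h \<and> h x = y"
    unfolding homeomorphic_map_maps by blast
qed

section \<open>The space of intervals as a triangle\<close>

definition triangle :: "(real \<times> real) set" where
  "triangle = {(x, y). 0 \<le> x \<and> x \<le> y \<and> y < 1}"

lemma topspace_triangle: "topspace (sorgenfrey_plane triangle) = triangle"
  by (auto simp: triangle_def)

text \<open>Preimages of the two kinds of subbasic Vietoris sets are checked to be open: an open
  \<open>V\<close> containing \<open>[x, y]\<close> contains some \<open>[x, y + d)\<close>, and a
  point of \<open>[x, y]\<close> in \<open>V\<close> can be pushed slightly to the right within
  \<open>V\<close>.\<close>

lemma continuous_map_interval:
  "continuous_map (sorgenfrey_plane triangle) C1_sorgenfrey (\<lambda>(a, b). {a..b})"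
proof -
  let ?f = "\<lambda>(a, b). {a..b::real}"
  have sub: "triangle \<subseteq> {0..<1} \<times> {0..<1}" by (auto simp: triangle_def)
  have ran: "?f z \<in> topspace C1_sorgenfrey" if "z \<in> triangle" for z
    using that unfolding topspace_C1_sorgenfrey triangle_def by auto
  then have ran': "?f z \<in> Exp sorgenfrey" if "z \<in> triangle" for z
    using that unfolding C1_sorgenfrey_def topspace_subtopology by auto
  have up: "openin (sorgenfrey_plane triangle) {z \<in> triangle. ?f z \<subseteq> V}"
    if V: "openin sorgenfrey V" for V
  proof (rule openin_sorgenfrey_planeI[OF sub])
    fix x y assume "(x, y) \<in> {z \<in> triangle. ?f z \<subseteq> V}"
    then have *: "{x..y} \<subseteq> V" "x \<le> y" by (auto simp: triangle_def)
    then obtain d where d: "d > 0" "{y..<y + d} \<subseteq> V"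
      using openin_sorgenfreyD[OF V, of y] by force
    have "{x..<y + d} \<subseteq> V"
      using * d by (smt (verit) atLeastAtMost_iff atLeastLessThan_iff subset_iff)
    with d(1) show "\<exists>d>0. triangle \<inter> {x..<x + d} \<times> {y..<y + d} \<subseteq> {z \<in> triangle. ?f z \<subseteq> V}"
      by (intro exI[of _ d]) (auto simp: subset_iff)
  qed auto
  have meet: "openin (sorgenfrey_plane triangle) {z \<in> triangle. ?f z \<inter> V \<noteq> {}}"
    if V: "openin sorgenfrey V" for V
  proof (rule openin_sorgenfrey_planeI[OF sub])
    fix x y assume "(x, y) \<in> {z \<in> triangle. ?f z \<inter> V \<noteq> {}}"
    then obtain z where z: "x \<le> z" "z \<le> y" "z \<in> V" by auto
    then obtain d where d: "d > 0" "{z..<z + d} \<subseteq> V"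
      using openin_sorgenfreyD[OF V, of z] by auto
    have "{x'..y'} \<inter> V \<noteq> {}"
      if "(x', y') \<in> triangle" "x' \<in> {x..<x + d}" "y' \<in> {y..<y + d}" for x' y'
    proof -
      \<comment> \<open>The moved interval may start to the right of \<open>z\<close>; its left end
        then replaces \<open>z\<close>, and \<open>x' < x + d \<le> z + d\<close> keeps it in
        \<open>V\<close>.\<close>
      have "max x' z \<in> {z..<z + d}" using that z d(1) by auto
      then have "max x' z \<in> V" using d(2) by blast
      moreover have "max x' z \<in> {x'..y'}" using that z by (auto simp: triangle_def)
      ultimately show ?thesis by blast
    qed
    with d(1) show "\<exists>d>0. triangle \<inter> {x..<x + d} \<times> {y..<y + d} \<subseteq> {z \<in> triangle. ?f z \<inter> V \<noteq> {}}"
      by (intro exI[of _ d]) auto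
  qed auto
  have vim1: "?f -` {F \<in> Exp sorgenfrey. F \<subseteq> V} \<inter> triangle = {z \<in> triangle. ?f z \<subseteq> V}" for V
    using ran' by blast
  have vim2: "?f -` {F \<in> Exp sorgenfrey. F \<inter> V \<noteq> {}} \<inter> triangle
      = {z \<in> triangle. ?f z \<inter> V \<noteq> {}}" for V
    using ran' by blast
  have "continuous_map (sorgenfrey_plane triangle) (vietoris sorgenfrey) ?f"
    unfolding vietoris_def
  proof (rule continuous_on_generated_topo)
    show "?f ` topspace (sorgenfrey_plane triangle) \<subseteq>
        \<Union> ({{F \<in> Exp sorgenfrey. F \<subseteq> V} |V. openin sorgenfrey V \<and> V \<noteq> {}} \<union>
           {{F \<in> Exp sorgenfrey. F \<inter> V \<noteq> {}} |V. openin sorgenfrey V \<and> V \<noteq> {}})"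
      \<comment> \<open>The union of the subbasic sets is the underlying set of the Vietoris
        topology, so this reduces to membership in \<open>Exp sorgenfrey\<close>.\<close>
      unfolding topspace_vietoris[of sorgenfrey, unfolded vietoris_def topology_generated_by_topspace]
        topspace_triangle
      using ran' by (rule image_subsetI)
  next
    fix U
    assume "U \<in> {{F \<in> Exp sorgenfrey. F \<subseteq> V} |V. openin sorgenfrey V \<and> V \<noteq> {}} \<union>
        {{F \<in> Exp sorgenfrey. F \<inter> V \<noteq> {}} |V. openin sorgenfrey V \<and> V \<noteq> {}}"
    then obtain V where V: "openin sorgenfrey V"
      and "U = {F \<in> Exp sorgenfrey. F \<subseteq> V} \<or> U = {F \<in> Exp sorgenfrey. F \<inter> V \<noteq> {}}"
      by blast
    then have "?f -` U \<inter> triangle = {z \<in> triangle. ?f z \<subseteq> V} \<or>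
        ?f -` U \<inter> triangle = {z \<in> triangle. ?f z \<inter> V \<noteq> {}}"
      using vim1 vim2 by (elim disjE) simp_all
    then show "openin (sorgenfrey_plane triangle) (?f -` U \<inter> topspace (sorgenfrey_plane triangle))"
      unfolding topspace_triangle using up[OF V] meet[OF V] by (elim disjE) simp_all
  qed
  then show ?thesis
    using ran unfolding C1_sorgenfrey_def continuous_map_in_subtopology topspace_subtopology
      topspace_triangle by auto
qed

lemma openin_C1_sorgenfrey:
  assumes "openin sorgenfrey V" "V \<noteq> {}"
  shows "openin C1_sorgenfrey {F \<in> topspace C1_sorgenfrey. F \<subseteq> V}"
    and "openin C1_sorgenfrey {F \<in> topspace C1_sorgenfrey. F \<inter> V \<noteq> {}}"
proof -
  have "openin (vietoris sorgenfrey) {F \<in> Exp sorgenfrey. F \<subseteq> V}"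
       "openin (vietoris sorgenfrey) {F \<in> Exp sorgenfrey. F \<inter> V \<noteq> {}}"
    unfolding vietoris_def using assms by (auto intro!: topology_generated_by_Basis)
  then show "openin C1_sorgenfrey {F \<in> topspace C1_sorgenfrey. F \<subseteq> V}"
    "openin C1_sorgenfrey {F \<in> topspace C1_sorgenfrey. F \<inter> V \<noteq> {}}"
    unfolding C1_sorgenfrey_def openin_subtopology topspace_subtopology topspace_vietoris
    by blast+
qed

lemma continuous_map_interval_ends:
  "continuous_map C1_sorgenfrey (sorgenfrey_plane triangle) (\<lambda>F. (Inf F, Sup F))"
proof -
  have rep: "\<exists>a b. F = {a..b} \<and> 0 \<le> a \<and> a \<le> b \<and> b < 1" if "F \<in> topspace C1_sorgenfrey" for F
    using that unfolding topspace_C1_sorgenfrey by auto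
  have near: "\<exists>U. openin C1_sorgenfrey U \<and> F \<in> U \<and>
      (\<forall>G\<in>U. (Inf F \<le> Inf G \<and> Inf G < Inf F + e) \<and> (Sup F \<le> Sup G \<and> Sup G < Sup F + e))"
    if F: "F \<in> topspace C1_sorgenfrey" and e: "e > 0" for F e
  proof -
    obtain a b where ab: "F = {a..b}" "0 \<le> a" "a \<le> b" "b < 1" using rep[OF F] by blast
    define V where "V = (\<lambda>c d. {c..<d} \<inter> {0..<1::real})"
    have V: "openin sorgenfrey (V c d)" if "0 \<le> c" for c d
      unfolding V_def using openin_sorgenfrey_atLeastLessThan[OF that] .
    \<comment> \<open>Containment bounds the left end from below and the right end from above;
      meeting \<open>[a, a + e)\<close> bounds the left end from above, and meeting
      \<open>[b, 1)\<close> bounds the right end from below.\<close>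
    define U where "U = {G \<in> topspace C1_sorgenfrey. G \<subseteq> V a (b + e)} \<inter>
      {G \<in> topspace C1_sorgenfrey. G \<inter> V a (a + e) \<noteq> {}} \<inter>
      {G \<in> topspace C1_sorgenfrey. G \<inter> V b 1 \<noteq> {}}"
    have "a \<in> V a (b + e)" "a \<in> V a (a + e)" "b \<in> V b 1"
      using ab e by (auto simp: V_def)
    then have "openin C1_sorgenfrey U"
      unfolding U_def using ab e by (intro openin_Int openin_C1_sorgenfrey V) auto
    moreover have "F \<subseteq> V a (b + e)" "a \<in> F" "b \<in> F" using ab e by (auto simp: V_def)
    then have "F \<in> U"
      using F \<open>a \<in> V a (a + e)\<close> \<open>b \<in> V b 1\<close> by (auto simp: U_def)
    moreover have "a \<le> Inf G \<and> Inf G < a + e \<and> b \<le> Sup G \<and> Sup G < b + e" if G: "G \<in> U" for G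
    proof -
      obtain c d where cd: "G = {c..d}" "0 \<le> c" "c \<le> d" "d < 1"
        using rep[of G] G by (auto simp: U_def)
      then have "c \<in> G" "d \<in> G" by auto
      moreover have "G \<subseteq> V a (b + e)" "G \<inter> V a (a + e) \<noteq> {}" "G \<inter> V b 1 \<noteq> {}"
        using that by (auto simp: U_def)
      ultimately have "a \<le> c" "d < b + e" "c < a + e" "b \<le> d"
        using cd by (fastforce simp: V_def)+
      then show ?thesis using cd by simp
    qed
    ultimately show ?thesis
      using ab by (intro exI[of _ U]) auto
  qed
  have ends: "Inf F \<in> {0..<1}" "Sup F \<in> {0..<1}" "(Inf F, Sup F) \<in> triangle"
    if "F \<in> topspace C1_sorgenfrey" for F
    using rep[OF that] by (auto simp: triangle_def)
  have "continuous_map C1_sorgenfrey sorgenfrey Inf"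
  proof (rule continuous_map_sorgenfreyI)
    show "\<exists>U. openin C1_sorgenfrey U \<and> F \<in> U \<and> (\<forall>G\<in>U. Inf F \<le> Inf G \<and> Inf G < Inf F + e)"
      if "F \<in> topspace C1_sorgenfrey" "e > 0" for F e
      using near[OF that] by blast
  qed (use ends in blast)
  moreover have "continuous_map C1_sorgenfrey sorgenfrey Sup"
  proof (rule continuous_map_sorgenfreyI)
    show "\<exists>U. openin C1_sorgenfrey U \<and> F \<in> U \<and> (\<forall>G\<in>U. Sup F \<le> Sup G \<and> Sup G < Sup F + e)"
      if "F \<in> topspace C1_sorgenfrey" "e > 0" for F e
      using near[OF that] by blast
  qed (use ends in blast)
  moreover have "(\<lambda>F. (Inf F, Sup F)) \<in> topspace C1_sorgenfrey \<rightarrow> triangle"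
    using ends(3) by blast
  ultimately show ?thesis
    by (simp only: continuous_map_in_subtopology continuous_map_paired simp_thms)
qed

lemma C1_sorgenfrey_homeomorphic_triangle:
  "C1_sorgenfrey homeomorphic_space sorgenfrey_plane triangle"
proof -
  have "homeomorphic_maps C1_sorgenfrey (sorgenfrey_plane triangle)
      (\<lambda>F. (Inf F, Sup F)) (\<lambda>(a, b). {a..b})"
    unfolding homeomorphic_maps_def topspace_triangle
  proof (intro conjI ballI)
    show "(case (Inf F, Sup F) of (a, b) \<Rightarrow> {a..b}) = F" if "F \<in> topspace C1_sorgenfrey" for F
      using that by (auto simp: topspace_C1_sorgenfrey)
    show "(Inf (case z of (a, b) \<Rightarrow> {a..b}), Sup (case z of (a, b) \<Rightarrow> {a..b})) = z"
      if "z \<in> triangle" for z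
      using that by (auto simp: triangle_def)
  qed (fact continuous_map_interval_ends continuous_map_interval)+
  then show ?thesis unfolding homeomorphic_space_def by blast
qed

section \<open>Fibrewise homeomorphisms\<close>

text \<open>The part of the square on or above the graph of \<open>b\<close>; the identity gives the
  triangle and the zero function the whole square.\<close>

definition region :: "(real \<Rightarrow> real) \<Rightarrow> (real \<times> real) set" where
  "region b = {(x, y). 0 \<le> x \<and> x < 1 \<and> b x \<le> y \<and> y < 1}"

text \<open>The break points \<open>p k x\<close> fall from 1 to the lower boundary
  \<open>b x\<close>, cutting each fibre into half-open bands. \<open>p_const\<close> freezes
  finitely many of them to the right of \<open>x\<close>, which gives continuity inside a band;
  \<open>b_mono\<close> keeps values from dropping at the lower boundary.\<close>

locale fan =
  fixes b :: "real \<Rightarrow> real" and p :: "nat \<Rightarrow> real \<Rightarrow> real"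
  assumes b_nonneg: "0 \<le> x \<Longrightarrow> x < 1 \<Longrightarrow> 0 \<le> b x"
    and b_mono: "0 \<le> x \<Longrightarrow> x \<le> x' \<Longrightarrow> x' < 1 \<Longrightarrow> b x \<le> b x'"
    and p_0: "0 \<le> x \<Longrightarrow> x < 1 \<Longrightarrow> p 0 x = 1"
    and p_above: "0 \<le> x \<Longrightarrow> x < 1 \<Longrightarrow> b x < p k x"
    and p_Suc: "0 \<le> x \<Longrightarrow> x < 1 \<Longrightarrow> p (Suc k) x < p k x"
    and p_conv: "0 \<le> x \<Longrightarrow> x < 1 \<Longrightarrow> e > 0 \<Longrightarrow> \<exists>k. p k x < b x + e"
    and p_const: "0 \<le> x \<Longrightarrow> x < 1 \<Longrightarrow> \<exists>d>0. \<forall>x'\<in>{x..<x + d}. x' < 1 \<longrightarrow> p k x' = p k x"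
begin

lemma p_antimono:
  assumes "0 \<le> x" "x < 1" "j \<le> k" shows "p k x \<le> p j x"
  using assms(3)
proof (induction k rule: dec_induct)
  case (step n)
  then show ?case using p_Suc[OF assms(1,2), of n] by simp
qed simp

lemma band_exists:
  assumes "0 \<le> x" "x < 1" "b x < y" "y < 1"
  shows "\<exists>k. p (Suc k) x \<le> y \<and> y < p k x"
proof -
  obtain K where K: "p K x < y"
    using p_conv[OF assms(1,2), of "y - b x"] assms(3) by auto
  define j where "j = (LEAST j. p j x \<le> y)"
  have j: "p j x \<le> y" unfolding j_def
    by (rule LeastI[where P = "\<lambda>j. p j x \<le> y", OF less_imp_le[OF K]])
  \<comment> \<open>Since \<open>p 0 x = 1\<close> exceeds \<open>y\<close>, the least index is a
    successor \<open>Suc k\<close>, and minimality gives \<open>y < p k x\<close>.\<close>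
  have "\<not> p 0 x \<le> y" using p_0 assms by simp
  with j obtain k where k: "j = Suc k" by (cases j) auto
  have "\<not> p k x \<le> y" using k unfolding j_def by (metis lessI not_less_Least)
  with j k show ?thesis by auto
qed

lemma band_Least:
  assumes "0 \<le> x" "x < 1" "p (Suc k) x \<le> y" "y < p k x"
  shows "(LEAST k. p (Suc k) x \<le> y) = k"
proof (rule Least_equality[where P = "\<lambda>k. p (Suc k) x \<le> y", OF assms(3)])
  fix j assume "p (Suc j) x \<le> y"
  then show "k \<le> j"
    using p_antimono[OF assms(1,2), of "Suc j" k] assms(4) by (cases "k \<le> j") auto
qed

lemma topspace_region: "topspace (sorgenfrey_plane (region b)) = region b"
  using b_nonneg by (fastforce simp: region_def)

end

text \<open>On each fibre this is the increasing piecewise affine map taking the \<open>k\<close>-th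
  band of the first fan onto the \<open>k\<close>-th band of the second. \<open>LEAST\<close> picks
  the band of \<open>y\<close>; within \<open>region b\<close> the first branch occurs only at
  \<open>y = b x\<close>.\<close>

definition fan_map ::
  "(real \<Rightarrow> real) \<Rightarrow> (nat \<Rightarrow> real \<Rightarrow> real) \<Rightarrow> (real \<Rightarrow> real) \<Rightarrow> (nat \<Rightarrow> real \<Rightarrow> real) \<Rightarrow> real \<times> real \<Rightarrow> real"
where
  "fan_map b p c q = (\<lambda>(x, y). if y \<le> b x then c x
     else let k = LEAST k. p (Suc k) x \<le> y
          in q (Suc k) x + (y - p (Suc k) x) * ((q k x - q (Suc k) x) / (p k x - p (Suc k) x)))"

locale two_fans = P: fan b p + Q: fan c q for b p c q
begin

lemma fan_map_base: "fan_map b p c q (x, b x) = c x"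
  by (simp add: fan_map_def)

lemma fan_map_band:
  assumes x: "0 \<le> x" "x < 1" and y: "p (Suc k) x \<le> y" "y < p k x"
  shows "fan_map b p c q (x, y) =
    q (Suc k) x + (y - p (Suc k) x) * ((q k x - q (Suc k) x) / (p k x - p (Suc k) x))"
  using P.band_Least[OF x y] P.p_above[OF x, of "Suc k"] y by (simp add: fan_map_def)

text \<open>Bands go to bands of the same index, as the affine piece has positive slope. Both the
  inverse and continuity at the lower boundary rest on this.\<close>

lemma fan_map_band_bounds:
  assumes x: "0 \<le> x" "x < 1" and y: "p (Suc k) x \<le> y" "y < p k x"
  shows "q (Suc k) x \<le> fan_map b p c q (x, y)" "fan_map b p c q (x, y) < q k x"
proof -
  have pq: "p k x - p (Suc k) x > 0" "q k x - q (Suc k) x > 0"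
    using P.p_Suc[OF x] Q.p_Suc[OF x] by simp_all
  then have s: "(q k x - q (Suc k) x) / (p k x - p (Suc k) x) > 0" by simp
  then show "q (Suc k) x \<le> fan_map b p c q (x, y)"
    unfolding fan_map_band[OF assms] using mult_nonneg_nonneg[OF _ less_imp_le[OF s]] y by simp
  have "(y - p (Suc k) x) * ((q k x - q (Suc k) x) / (p k x - p (Suc k) x))
      < (p k x - p (Suc k) x) * ((q k x - q (Suc k) x) / (p k x - p (Suc k) x))"
    using s y by (intro mult_strict_right_mono) auto
  then show "fan_map b p c q (x, y) < q k x"
    unfolding fan_map_band[OF assms] using pq by simp
qed

lemma fan_map_cases:
  assumes "(x, y) \<in> region b"
  obtains "0 \<le> x" "x < 1" "y = b x"
  | k where "0 \<le> x" "x < 1" "b x < y" "p (Suc k) x \<le> y" "y < p k x"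
  using assms P.band_exists[of x y] by (fastforce simp: region_def)

lemma fan_map_bounds:
  assumes z: "(x, y) \<in> region b"
  shows "c x \<le> fan_map b p c q (x, y)" "fan_map b p c q (x, y) < 1"
proof -
  have "c x \<le> fan_map b p c q (x, y) \<and> fan_map b p c q (x, y) < 1"
    using z
  proof (cases rule: fan_map_cases)
    case 1
    then show ?thesis using Q.p_above[of x 0] Q.p_0[of x] by (simp add: fan_map_base)
  next
    case (2 k)
    then show ?thesis
      using fan_map_band_bounds[of x k y] Q.p_above[of x "Suc k"] Q.p_antimono[of x 0 k] Q.p_0[of x]
      by simp
  qed
  then show "c x \<le> fan_map b p c q (x, y)" "fan_map b p c q (x, y) < 1" by auto
qed

lemma fan_map_inverse:
  assumes z: "(x, y) \<in> region b"
  shows "fan_map c q b p (x, fan_map b p c q (x, y)) = y"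
proof -
  \<comment> \<open>The assumptions are symmetric in the two fans, so exchanging them supplies the
    candidate inverse; on bands of equal index the slopes are reciprocal.\<close>
  interpret R: two_fans c q b p by unfold_locales
  show ?thesis
    using z
  proof (cases rule: fan_map_cases)
    case 1
    then show ?thesis by (simp add: fan_map_base R.fan_map_base)
  next
    case (2 k)
    note bounds = fan_map_band_bounds[OF 2(1,2,4,5)]
    have "p k x - p (Suc k) x \<noteq> 0" "q k x - q (Suc k) x \<noteq> 0"
      using P.p_Suc[of x k] Q.p_Suc[of x k] 2 by simp_all
    then show ?thesis
      unfolding R.fan_map_band[OF 2(1,2) bounds] unfolding fan_map_band[OF 2(1,2,4,5)] by simp
  qed
qed

text \<open>Close to the lower boundary the band index is at least \<open>K\<close>, so the image
  lies below \<open>q K\<close>, which is within \<open>e\<close> of \<open>c x\<close>. The lower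
  bound comes from monotonicity of \<open>c\<close>.\<close>

lemma fan_map_continuous_base:
  assumes x: "0 \<le> x" "x < 1" and e: "e > 0"
  shows "\<exists>d>0. \<forall>x'\<in>{x..<x + d}. \<forall>y'\<in>{b x..<b x + d}. (x', y') \<in> region b \<longrightarrow>
    c x \<le> fan_map b p c q (x', y') \<and> fan_map b p c q (x', y') < c x + e"
proof -
  obtain K where K: "q K x < c x + e" using Q.p_conv[OF x e] by blast
  obtain d1 where d1: "d1 > 0" "\<And>x'. x' \<in> {x..<x + d1} \<Longrightarrow> x' < 1 \<Longrightarrow> p K x' = p K x"
    using P.p_const[OF x, of K] by blast
  obtain d2 where d2: "d2 > 0" "\<And>x'. x' \<in> {x..<x + d2} \<Longrightarrow> x' < 1 \<Longrightarrow> q K x' = q K x"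
    using Q.p_const[OF x, of K] by blast
  \<comment> \<open>The entry \<open>p K x - b x\<close> keeps \<open>y'\<close> below the break
    point \<open>p K x\<close>, which is unchanged at \<open>x'\<close>.\<close>
  define d where "d = Min {d1, d2, p K x - b x}"
  have d: "d > 0" "d \<le> d1" "d \<le> d2" "d \<le> p K x - b x"
    using d1(1) d2(1) P.p_above[OF x, of K] by (auto simp: d_def)
  have "c x \<le> fan_map b p c q (x', y') \<and> fan_map b p c q (x', y') < c x + e"
    if x': "x' \<in> {x..<x + d}" and y': "y' \<in> {b x..<b x + d}" and z: "(x', y') \<in> region b" for x' y'
  proof
    have x'01: "0 \<le> x'" "x' < 1" using z by (auto simp: region_def)
    show "c x \<le> fan_map b p c q (x', y')"
      using fan_map_bounds(1)[OF z] Q.b_mono[of x x'] x x' x'01 by simp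
    have pK: "y' < p K x'" using d d1(2)[of x'] x' x'01 y' by simp
    have qK: "q K x' = q K x" using d d2(2)[of x'] x' x'01 by simp
    have "fan_map b p c q (x', y') < q K x'"
      using z
    proof (cases rule: fan_map_cases)
      case 1
      then show ?thesis using Q.p_above[of x' K] by (simp add: fan_map_base)
    next
      case (2 k)
      then have "K \<le> k"
        \<comment> \<open>If \<open>k < K\<close>, then
          \<open>p K x' \<le> p (Suc k) x' \<le> y'\<close>, contradicting
          \<open>pK\<close>.\<close>
        using P.p_antimono[of x' "Suc k" K] pK by (cases "K \<le> k") auto
      with 2 show ?thesis
        using fan_map_band_bounds(2)[of x' k y'] Q.p_antimono[of x' K k] by simp
    qed
    with K qK show "fan_map b p c q (x', y') < c x + e" by simp
  qed
  with d(1) show ?thesis by blast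
qed

text \<open>The four break points bounding the band and its image are constant to the right of
  \<open>x\<close>, so there the map is one affine function of \<open>y\<close> alone. Half-open
  bands leave room above \<open>y\<close> even when \<open>y\<close> is a break point.\<close>

lemma fan_map_continuous_band:
  assumes x: "0 \<le> x" "x < 1" and y: "p (Suc k) x \<le> y" "y < p k x" and e: "e > 0"
  shows "\<exists>d>0. \<forall>x'\<in>{x..<x + d}. \<forall>y'\<in>{y..<y + d}. (x', y') \<in> region b \<longrightarrow>
    fan_map b p c q (x, y) \<le> fan_map b p c q (x', y') \<and>
    fan_map b p c q (x', y') < fan_map b p c q (x, y) + e"
proof -
  obtain d1 where d1: "d1 > 0" "\<And>x'. x' \<in> {x..<x + d1} \<Longrightarrow> x' < 1 \<Longrightarrow> p k x' = p k x"
    using P.p_const[OF x, of k] by blast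
  obtain d2 where d2: "d2 > 0" "\<And>x'. x' \<in> {x..<x + d2} \<Longrightarrow> x' < 1 \<Longrightarrow> p (Suc k) x' = p (Suc k) x"
    using P.p_const[OF x, of "Suc k"] by blast
  obtain d3 where d3: "d3 > 0" "\<And>x'. x' \<in> {x..<x + d3} \<Longrightarrow> x' < 1 \<Longrightarrow> q k x' = q k x"
    using Q.p_const[OF x, of k] by blast
  obtain d4 where d4: "d4 > 0" "\<And>x'. x' \<in> {x..<x + d4} \<Longrightarrow> x' < 1 \<Longrightarrow> q (Suc k) x' = q (Suc k) x"
    using Q.p_const[OF x, of "Suc k"] by blast
  define s where "s = (q k x - q (Suc k) x) / (p k x - p (Suc k) x)"
  have s: "s > 0" unfolding s_def using P.p_Suc[OF x, of k] Q.p_Suc[OF x, of k] by simp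
  \<comment> \<open>\<open>p k x - y\<close> prevents leaving the band, and \<open>e / s\<close>
    bounds the rise for slope \<open>s\<close>.\<close>
  define d where "d = Min {d1, d2, d3, d4, p k x - y, e / s}"
  have d: "d > 0" "d \<le> d1" "d \<le> d2" "d \<le> d3" "d \<le> d4" "d \<le> p k x - y" "d \<le> e / s"
    using d1(1) d2(1) d3(1) d4(1) y e s by (auto simp: d_def)
  have "fan_map b p c q (x, y) \<le> fan_map b p c q (x', y') \<and>
    fan_map b p c q (x', y') < fan_map b p c q (x, y) + e"
    if x': "x' \<in> {x..<x + d}" and y': "y' \<in> {y..<y + d}" and z: "(x', y') \<in> region b" for x' y'
  proof -
    have x'01: "0 \<le> x'" "x' < 1" using z by (auto simp: region_def)
    have eq: "p k x' = p k x" "p (Suc k) x' = p (Suc k) x" "q k x' = q k x"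
      "q (Suc k) x' = q (Suc k) x"
      using d d1(2)[of x'] d2(2)[of x'] d3(2)[of x'] d4(2)[of x'] x' x'01 by simp_all
    have band: "p (Suc k) x' \<le> y'" "y' < p k x'" using eq y y' d by simp_all
    have "fan_map b p c q (x', y') = fan_map b p c q (x, y) + (y' - y) * s"
      unfolding fan_map_band[OF x'01 band] fan_map_band[OF x y] eq s_def[symmetric]
      by (simp add: algebra_simps)
    moreover have "0 \<le> (y' - y) * s" using y' s by simp
    moreover have "y' - y < e / s" using y' d(7) by simp
    then have "(y' - y) * s < e" using s by (simp add: pos_less_divide_eq)
    ultimately show ?thesis by simp
  qed
  with d(1) show ?thesis by blast
qed

lemma continuous_map_fan_map:
  "continuous_map (sorgenfrey_plane (region b)) (sorgenfrey_plane (region c))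
     (\<lambda>z. (fst z, fan_map b p c q z))"
proof -
  have sub: "region b \<subseteq> {0..<1} \<times> {0..<1}"
    using P.b_nonneg by (fastforce simp: region_def)
  have "continuous_map (sorgenfrey_plane (region b)) sorgenfrey (fan_map b p c q)"
  proof (rule continuous_map_sorgenfrey_plane_sorgenfreyI[OF sub])
    fix x y assume z: "(x, y) \<in> region b"
    then show "fan_map b p c q (x, y) \<in> {0..<1}"
      using fan_map_bounds[OF z] Q.b_nonneg[of x] by (auto simp: region_def)
    fix e :: real assume e: "e > 0"
    from z show "\<exists>d>0. \<forall>x'\<in>{x..<x + d}. \<forall>y'\<in>{y..<y + d}. (x', y') \<in> region b \<longrightarrow>
      fan_map b p c q (x, y) \<le> fan_map b p c q (x', y') \<and>
      fan_map b p c q (x', y') < fan_map b p c q (x, y) + e"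
    proof (cases rule: fan_map_cases)
      case 1
      then show ?thesis using fan_map_continuous_base[OF _ _ e] by (simp add: fan_map_base)
    next
      case 2
      then show ?thesis using fan_map_continuous_band e by blast
    qed
  qed
  moreover have "continuous_map (sorgenfrey_plane (region b)) sorgenfrey fst"
    by (intro continuous_map_from_subtopology continuous_map_fst)
  moreover have "(\<lambda>z. (fst z, fan_map b p c q z)) \<in> topspace (sorgenfrey_plane (region b)) \<rightarrow> region c"
    unfolding P.topspace_region using fan_map_bounds by (auto simp: region_def)
  ultimately show ?thesis
    by (simp only: continuous_map_in_subtopology continuous_map_paired simp_thms)
qed

lemma regions_homeomorphic:
  "sorgenfrey_plane (region b) homeomorphic_space sorgenfrey_plane (region c)"
proof -
  interpret R: two_fans c q b p by unfold_locales
  have "homeomorphic_maps (sorgenfrey_plane (region b)) (sorgenfrey_plane (region c))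
      (\<lambda>z. (fst z, fan_map b p c q z)) (\<lambda>z. (fst z, fan_map c q b p z))"
    unfolding homeomorphic_maps_def P.topspace_region Q.topspace_region
    using continuous_map_fan_map R.continuous_map_fan_map
    by (auto simp: fan_map_inverse R.fan_map_inverse)
  then show ?thesis unfolding homeomorphic_space_def by blast
qed

end

section \<open>Locally constant break points\<close>

text \<open>Floor is continuous from the right: values approaching \<open>f x\<close> from above
  stay below the next integer.\<close>

lemma eventually_floor_at_right_eq:
  fixes f :: "real \<Rightarrow> real"
  assumes "(f \<longlongrightarrow> f x) (at_right x)" and "\<forall>\<^sub>F z in at_right x. f x \<le> f z"
  shows "\<forall>\<^sub>F z in at_right x. \<lfloor>f z\<rfloor> = \<lfloor>f x\<rfloor>"
proof -
  have "\<forall>\<^sub>F z in at_right x. f z < of_int \<lfloor>f x\<rfloor> + 1"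
    by (rule order_tendstoD(2)[OF assms(1)]) linarith
  with assms(2) show ?thesis
    by eventually_elim linarith
qed

text \<open>The denominator is the least integer \<open>m\<close> for which \<open>1/m\<close> is smaller than the gap
  \<open>break_point k x - x\<close>; it grows by at least one in each step.\<close>

fun break_point :: "nat \<Rightarrow> real \<Rightarrow> real" where
  "break_point 0 x = 1"
| "break_point (Suc k) x =
     (let m = of_int (\<lfloor>1 / (break_point k x - x)\<rfloor> + 1) in (of_int \<lfloor>m * x\<rfloor> + 1) / m)"

text \<open>The next break point is the first multiple of \<open>1 / m\<close> strictly beyond
  \<open>x\<close>, so it is at most \<open>1 / m\<close> away, and \<open>1 / m\<close> is less
  than the current gap.\<close>

lemma break_point_Suc_bounds:
  fixes x :: real and k :: nat
  defines "m \<equiv> of_int (\<lfloor>1 / (break_point k x - x)\<rfloor> + 1)"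
  assumes "x < break_point k x"
  shows "m > 0" "1 / m < break_point k x - x"
    "x < break_point (Suc k) x" "break_point (Suc k) x \<le> x + 1 / m"
proof -
  have gap: "1 / (break_point k x - x) < m"
    unfolding m_def by linarith
  have "1 / (break_point k x - x) > 0" using assms by simp
  with gap show m: "m > 0" by linarith
  show "1 / m < break_point k x - x"
    using gap m assms(2) by (simp add: field_simps)
  have eq: "break_point (Suc k) x = (of_int \<lfloor>m * x\<rfloor> + 1) / m"
    by (simp add: m_def Let_def)
  have "m * x < of_int \<lfloor>m * x\<rfloor> + 1" "of_int \<lfloor>m * x\<rfloor> + 1 \<le> m * x + 1" by linarith+
  with m show "x < break_point (Suc k) x" "break_point (Suc k) x \<le> x + 1 / m"
    unfolding eq by (simp_all add: field_simps)
qed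

lemma break_point_gt: "x < 1 \<Longrightarrow> x < break_point k x"
proof (induction k)
  case (Suc k)
  then show ?case using break_point_Suc_bounds(3) by blast
qed simp

lemma break_point_gap:
  assumes "x < 1" shows "real k \<le> 1 / (break_point k x - x)"
proof (induction k)
  case 0
  then show ?case using assms by simp
next
  case (Suc k)
  define m :: real where "m = of_int (\<lfloor>1 / (break_point k x - x)\<rfloor> + 1)"
  \<comment> \<open>Passing to the floor loses nothing because \<open>k\<close> is an integer; the
    added 1 in \<open>m\<close> then gives \<open>Suc k\<close>.\<close>
  have "int k \<le> \<lfloor>1 / (break_point k x - x)\<rfloor>"
    using Suc.IH by (simp add: le_floor_iff)
  then have "real (Suc k) \<le> m"
    unfolding m_def by linarith
  also have "m \<le> 1 / (break_point (Suc k) x - x)"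
    using break_point_Suc_bounds[OF break_point_gt[OF assms, of k]]
    unfolding m_def[symmetric] by (simp add: field_simps)
  finally show ?case .
qed

text \<open>By induction the previous break point may be frozen as \<open>c\<close>. Then
  \<open>1 / (c - z)\<close> and \<open>m * z\<close> increase continuously in \<open>z\<close>, so
  both floors in the recursion are constant just to the right of \<open>x\<close>.\<close>

lemma break_point_right_constant:
  assumes "x < 1" shows "\<forall>\<^sub>F z in at_right x. break_point k z = break_point k x"
proof (induction k)
  case (Suc k)
  define c where "c = break_point k x"
  have c: "x < c" unfolding c_def by (rule break_point_gt[OF assms])
  have "\<forall>\<^sub>F z in at_right x. \<lfloor>1 / (c - z)\<rfloor> = \<lfloor>1 / (c - x)\<rfloor>"
  proof (rule eventually_floor_at_right_eq)
    show "((\<lambda>z. 1 / (c - z)) \<longlongrightarrow> 1 / (c - x)) (at_right x)"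
      using c by (intro tendsto_intros) auto
    have "\<forall>\<^sub>F z in at_right x. z \<in> {x<..<c}"
      using c by (rule eventually_at_right_real)
    then show "\<forall>\<^sub>F z in at_right x. 1 / (c - x) \<le> 1 / (c - z)"
      by eventually_elim (auto intro!: divide_left_mono)
  qed
  moreover
  define m :: real where "m = of_int (\<lfloor>1 / (c - x)\<rfloor> + 1)"
  have m: "m > 0"
    using break_point_Suc_bounds(1)[of x k] c unfolding m_def c_def by simp
  have "\<forall>\<^sub>F z in at_right x. \<lfloor>m * z\<rfloor> = \<lfloor>m * x\<rfloor>"
  proof (rule eventually_floor_at_right_eq)
    show "((\<lambda>z. m * z) \<longlongrightarrow> m * x) (at_right x)" by (intro tendsto_intros)
    have "\<forall>\<^sub>F z in at_right x. z > x" by (simp add: eventually_at_right_less)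
    then show "\<forall>\<^sub>F z in at_right x. m * x \<le> m * z"
      by eventually_elim (use m in simp)
  qed
  ultimately show ?case
    using Suc.IH by eventually_elim (simp add: Let_def c_def m_def)
qed simp

section \<open>The two concrete fans and the conclusion\<close>

lemma fan_break_point: "fan (\<lambda>x. x) break_point"
proof
  fix x :: real and k assume x: "0 \<le> x" "x < 1"
  show "x < break_point k x" using break_point_gt x by blast
  show "break_point (Suc k) x < break_point k x"
    using break_point_Suc_bounds(2,4)[OF break_point_gt[OF x(2), of k]] by linarith
  have "\<forall>\<^sub>F z in at_right x. break_point k z = break_point k x"
    using break_point_right_constant[OF x(2)] .
  then obtain u where "u > x" "\<forall>z>x. z < u \<longrightarrow> break_point k z = break_point k x"
    unfolding eventually_at_right_field by blast
  then show "\<exists>d>0. \<forall>x'\<in>{x..<x + d}. x' < 1 \<longrightarrow> break_point k x' = break_point k x"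
    by (intro exI[of _ "u - x"]) (auto simp: order.order_iff_strict)
next
  fix x e :: real assume x: "0 \<le> x" "x < 1" and e: "e > 0"
  \<comment> \<open>The reciprocal of the \<open>k\<close>-th gap is at least \<open>k\<close>, so
    any \<open>k\<close> above \<open>1 / e\<close> makes the gap smaller than
    \<open>e\<close>.\<close>
  obtain k where k: "real k > 1 / e" using reals_Archimedean2 by blast
  have "1 / e < 1 / (break_point k x - x)"
    using k break_point_gap[OF x(2), of k] by linarith
  then have "break_point k x - x < e"
    using break_point_gt[OF x(2), of k] e by (simp add: field_simps)
  then show "\<exists>k. break_point k x < x + e" by (intro exI[of _ k]) simp
qed auto

lemma fan_power: "fan (\<lambda>x. 0) (\<lambda>k x. (1 / 2) ^ k)"
proof
  fix e :: real assume "e > 0"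
  then show "\<exists>k. (1 / 2) ^ k < 0 + e"
    using real_arch_pow_inv[of e "1 / 2"] by simp
qed (auto intro: exI[of _ 1])

lemma triangle_homeomorphic_square:
  "sorgenfrey_plane triangle homeomorphic_space prod_topology sorgenfrey sorgenfrey"
proof -
  interpret two_fans "\<lambda>x. x" break_point "\<lambda>x. 0" "\<lambda>k x. (1 / 2) ^ k"
    by (intro two_fans.intro fan_break_point fan_power)
  have "region (\<lambda>x. x) = triangle" by (auto simp: region_def triangle_def)
  moreover have "sorgenfrey_plane (region (\<lambda>x. 0)) = prod_topology sorgenfrey sorgenfrey"
    by (rule subtopology_superset) (auto simp: region_def)
  ultimately show ?thesis using regions_homeomorphic by simp
qed

theorem corollary3p2:
  shows "homogeneous_space C1_sorgenfrey"
proof (rule homogeneous_space_homeomorphic)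
  show "C1_sorgenfrey homeomorphic_space prod_topology sorgenfrey sorgenfrey"
    using C1_sorgenfrey_homeomorphic_triangle triangle_homeomorphic_square
    by (rule homeomorphic_space_trans)
  show "homogeneous_space (prod_topology sorgenfrey sorgenfrey)"
    by (intro homogeneous_space_prod_topology homogeneous_space_sorgenfrey)
qed

end
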